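(* Let $\mathcal{P}:=\{(x,x^2):x\in[0,1]\}$, let $s\in(0,1]$ and let $\psi:\mathbb{N}\to[0,\infty)$ be any function (not necessarily monotonic). If $\sum_{q=1}^\infty \psi(q)^{s}q^{2-s}<\infty$, then $\mathcal{H}^s(\mathscr{A}_2(\psi)\cap\mathcal{P})=0$.
   Context: $\mathcal{H}^s$ denotes the $s$-dimensional Hausdorff measure on $\mathbb{R}^2$. For $\psi:\mathbb{N}\to[0,\infty)$, $\mathscr{A}_2(\psi):=\{\mathbf{x}\in\mathbb{R}^2:\ \text{there are infinitely many } \mathbf{q}\in\mathbb{Z}^2\setminus\{\mathbf{0}\} \text{ with } \|\mathbf{q}\cdot\mathbf{x}\|<\psi(|\mathbf{q}|_\infty)\}$, where $|\mathbf{q}|_\infty=\max(|q_1|,|q_2|)$ and $\|\cdot\|$ denotes the distance to the nearest integer. *)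

theory Defs
  imports "HOL-Analysis.Analysis"
begin

text \<open>
  The weight of a covering set in the definition of the \<open>s\<close>-dimensional Hausdorff measure,
  intended for \<open>s \<ge> 0\<close>. The case \<open>s = 0\<close> is separate because \<open>0 powr 0 = 0\<close>.
\<close>
definition hausdorff_weight :: "real \<Rightarrow> 'a::metric_space set \<Rightarrow> ennreal" where
  "hausdorff_weight s U =
     (if U = {} then 0 else if s = 0 then 1 else ennreal (diameter U powr s))"

text \<open>
  Sequences of sets cover the case of finite families as well, since a member may be empty.
  Boundedness is required explicitly because \<^const>\<open>diameter\<close> is a real number and is
  unspecified on unbounded sets.
\<close>
definition hausdorff_content :: "real \<Rightarrow> real \<Rightarrow> 'a::metric_space set \<Rightarrow> ennreal" where
  "hausdorff_content s \<delta> A =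
     (INF U \<in> {U :: nat \<Rightarrow> 'a set.
                 A \<subseteq> (\<Union>n. U n) \<and> (\<forall>n. bounded (U n) \<and> diameter (U n) \<le> \<delta>)}.
        (\<Sum>n. hausdorff_weight s (U n)))"

text \<open>
  The supremum over \<open>\<delta> > 0\<close> is the limit as \<open>\<delta>\<close> tends to \<open>0\<close>, as the
  content increases when \<open>\<delta>\<close> decreases. No normalising constant is included.
\<close>
definition hausdorff_measure :: "real \<Rightarrow> 'a::metric_space set \<Rightarrow> ennreal" where
  "hausdorff_measure s A = (SUP \<delta> \<in> {0<..}. hausdorff_content s \<delta> A)"

definition dist_nearest_int :: "real \<Rightarrow> real" where
  "dist_nearest_int t = infdist t \<int>"

definition max_norm :: "int ^ 2 \<Rightarrow> nat" where
  "max_norm q = nat (max \<bar>q $ 1\<bar> \<bar>q $ 2\<bar>)"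

definition dual_approximable :: "(nat \<Rightarrow> real) \<Rightarrow> (real ^ 2) set" where
  "dual_approximable \<psi> =
     {x. infinite {q :: int ^ 2. q \<noteq> 0 \<and>
           dist_nearest_int ((\<chi> i. of_int (q $ i)) \<bullet> x) < \<psi> (max_norm q)}}"

definition parabola :: "(real ^ 2) set" where
  "parabola = (\<lambda>x. vector [x, x\<^sup>2]) ` {0..1}"

end

theory Submission
  imports Defs "HOL-Computational_Algebra.Squarefree"
begin

text \<open>
  Write \<open>(a, b)\<close> for \<open>q\<close> and \<open>n\<close> for its height. A point \<open>(x, x\<^sup>2)\<close> approximated by \<open>q\<close> satisfies
  \<open>\<bar>b x\<^sup>2 + a x - c\<bar> < \<psi> n\<close> for an integer \<open>c\<close> with \<open>\<bar>c\<bar> \<le> 3 n\<close>. Let \<open>D = a\<^sup>2 + 4 b c\<close>. If \<open>D \<noteq> 0\<close>, then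
  \<open>x\<close> lies in one of two intervals of radius \<open>2 \<psi> n / sqrt \<bar>D\<bar>\<close>; as \<open>c\<close> varies \<open>D\<close> runs through an
  arithmetic progression with difference \<open>4 b\<close>, so that at height \<open>n\<close> the sum of \<open>1 / sqrt \<bar>D\<bar>\<close> is \<open>O(n)\<close>
  over \<open>O(n\<^sup>2)\<close> triples, and these intervals contribute \<open>O(\<psi>(n)\<^sup>s n\<^bsup>2-s\<^esup>)\<close>.

  If \<open>D = 0\<close>, there is a double root and the radius is only \<open>sqrt (\<psi> n / \<bar>b\<bar>)\<close>, where \<open>\<bar>b\<bar> \<ge> n / 12\<close>.
  With \<open>t\<^sub>n\<close> such triples the contribution is \<open>O(t\<^sub>n (\<psi> n / n)\<^bsup>s/2\<^esup>)\<close>, which AM-GM bounds by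
  \<open>\<psi>(n)\<^sup>s n\<^bsup>2-s\<^esup> + t\<^sub>n\<^sup>2 / n\<^sup>2\<close> up to a constant. Since \<open>b\<close> divides \<open>a\<^sup>2\<close>, either \<open>\<bar>b\<bar> = n\<close> and \<open>n\<close> divides \<open>a\<^sup>2\<close>, which
  happens for \<open>O(m)\<close> values of \<open>a\<close> where \<open>m\<^sup>2\<close> is the largest square dividing \<open>n\<close>, or \<open>\<bar>a\<bar> = n\<close> and \<open>b\<close>
  divides \<open>n\<^sup>2\<close>, which happens for \<open>O(n\<^bsup>1/3\<^esup>)\<close> values of \<open>b\<close> by the divisor bound. Hence
  \<open>\<Sum> t\<^sub>n\<^sup>2 / n\<^sup>2\<close> converges, and a Borel--Cantelli argument concludes.
\<close>

section \<open>Limsup sets of measure zero\<close>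

text \<open>
  The tail cover is automatically fine, since each \<open>diameter U powr s\<close> is bounded by the tail sum of \<open>F\<close>.
\<close>

lemma hausdorff_measure_limsup_null:
  fixes E :: "nat \<Rightarrow> 'a::metric_space set"
  assumes s: "0 < s" and F: "summable F"
    and cover: "\<And>n. n \<ge> N \<Longrightarrow> \<exists>\<F>. finite \<F> \<and> E n \<subseteq> \<Union>\<F> \<and> (\<forall>U\<in>\<F>. bounded U) \<and>
                  (\<Sum>U\<in>\<F>. diameter U powr s) \<le> F n"
    and A: "\<And>x. x \<in> A \<Longrightarrow> infinite {n. x \<in> E n}"
  shows "hausdorff_measure s A = 0"
proof -
  have content: "hausdorff_content s \<delta> A \<le> 0 + ennreal \<epsilon>" if \<delta>: "\<delta> > 0" and \<epsilon>: "\<epsilon> > 0" for \<delta> \<epsilon> :: real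
  proof -
    \<comment> \<open>The bound \<open>\<epsilon>\<close> controls the total weight of the tail
      cover, the bound \<open>\<delta> powr s\<close> the size of each single member.\<close>
    have "\<exists>L. \<forall>n\<ge>L. norm (\<Sum>i. F (i + n)) < min \<epsilon> (\<delta> powr s)"
      by (rule suminf_exist_split[OF _ F]) (use \<epsilon> \<delta> in simp)
    then obtain L where L: "\<And>n. n \<ge> L \<Longrightarrow> norm (\<Sum>i. F (i + n)) < min \<epsilon> (\<delta> powr s)"
      by blast
    define M where "M = max L N"
    have tail: "(\<Sum>i. F (i + M)) < \<epsilon>" "(\<Sum>i. F (i + M)) < \<delta> powr s"
      using L[of M] by (auto simp: M_def)
    have sumM: "summable (\<lambda>i. F (i + M))"
      using F by (simp add: summable_iff_shift)
    have le_N: "N \<le> n + M" for n by (simp add: M_def)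
    have "\<forall>n. \<exists>xs. distinct xs \<and> E (n + M) \<subseteq> \<Union>(set xs) \<and> (\<forall>U\<in>set xs. bounded U) \<and>
                  (\<Sum>U\<in>set xs. diameter U powr s) \<le> F (n + M)"
    proof
      fix n
      obtain \<F> where \<F>: "finite \<F>" "E (n + M) \<subseteq> \<Union>\<F>" "\<forall>U\<in>\<F>. bounded U"
          "(\<Sum>U\<in>\<F>. diameter U powr s) \<le> F (n + M)"
        using cover[OF le_N[of n]] by blast
      obtain xs where "set xs = \<F>" "distinct xs"
        using finite_distinct_list[OF \<F>(1)] by blast
      then show "\<exists>xs. distinct xs \<and> E (n + M) \<subseteq> \<Union>(set xs) \<and> (\<forall>U\<in>set xs. bounded U) \<and>
                  (\<Sum>U\<in>set xs. diameter U powr s) \<le> F (n + M)"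
        using \<F> by auto
    qed
    then obtain xs where xs: "\<And>n. distinct (xs n)" "\<And>n. E (n + M) \<subseteq> \<Union>(set (xs n))"
      "\<And>n U. U \<in> set (xs n) \<Longrightarrow> bounded U"
      "\<And>n. (\<Sum>U\<in>set (xs n). diameter U powr s) \<le> F (n + M)"
      by metis
    have Fnn: "F (n + M) \<ge> 0" for n
      using xs(4)[of n] by (smt (verit) powr_ge_zero sum_nonneg)
    \<comment> \<open>Each finite cover, listed without repetition, is padded with empty sets of
      weight 0. The resulting double family is enumerated by \<open>prod_decode\<close>, because the
      content is defined through sequences.\<close>
    define f where "f = (\<lambda>(n, k). if k < length (xs n) then xs n ! k else {})"
    define U where "U = (\<lambda>i. f (prod_decode i))"
    have weight: "(\<Sum>k. hausdorff_weight s (f (n, k))) \<le> ennreal (F (n + M))" for n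
    proof -
      have "(\<Sum>k. hausdorff_weight s (f (n, k))) = (\<Sum>k<length (xs n). hausdorff_weight s (f (n, k)))"
        by (rule suminf_finite) (auto simp: f_def hausdorff_weight_def)
      also have "\<dots> = (\<Sum>V\<in>set (xs n). hausdorff_weight s V)"
        by (rule sum.reindex_bij_betw[OF bij_betw_cong[THEN iffD1, OF _ bij_betw_nth[OF xs(1) refl refl]]])
           (auto simp: f_def)
      also have "\<dots> \<le> (\<Sum>V\<in>set (xs n). ennreal (diameter V powr s))"
        by (rule sum_mono) (use s in \<open>auto simp: hausdorff_weight_def\<close>)
      also have "\<dots> = ennreal (\<Sum>V\<in>set (xs n). diameter V powr s)"
        by (rule sum_ennreal) auto
      finally show ?thesis
        using xs(4)[of n] by (meson ennreal_leI order_trans)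
    qed
    have diam: "diameter V \<le> \<delta>" if V: "V \<in> set (xs n)" for V n
    proof (rule ccontr)
      assume "\<not> ?thesis"
      then have "\<delta> powr s < diameter V powr s"
        using s \<delta> by (intro powr_less_mono2) auto
      also have "\<dots> \<le> (\<Sum>U\<in>set (xs n). diameter U powr s)"
        by (rule member_le_sum) (use V in auto)
      also have "\<dots> \<le> F (n + M)" by (rule xs)
      also have "\<dots> = (\<Sum>i\<in>{n}. F (i + M))" by simp
      also have "\<dots> \<le> (\<Sum>i. F (i + M))"
        by (rule sum_le_suminf[OF sumM]) (use Fnn in auto)
      finally show False using tail by simp
    qed
    have "A \<subseteq> (\<Union>i. U i)"
    proof
      fix x assume "x \<in> A"
      then have "infinite {n. x \<in> E n}" by (rule A)
      then obtain n where "n \<ge> M" "x \<in> E n"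
        by (metis infinite_nat_iff_unbounded_le mem_Collect_eq)
      then have "x \<in> E ((n - M) + M)" by simp
      then obtain V where "V \<in> set (xs (n - M))" "x \<in> V" using xs(2) by blast
      then obtain k where "k < length (xs (n - M))" "x \<in> xs (n - M) ! k"
        by (metis in_set_conv_nth)
      then have "x \<in> U (prod_encode (n - M, k))" by (simp add: U_def f_def)
      then show "x \<in> (\<Union>i. U i)" by blast
    qed
    moreover have "bounded (U i) \<and> diameter (U i) \<le> \<delta>" for i
      using xs(3)[OF nth_mem] diam[OF nth_mem] \<delta> by (cases "prod_decode i") (auto simp: U_def f_def)
    ultimately have "hausdorff_content s \<delta> A \<le> (\<Sum>i. hausdorff_weight s (U i))"
      unfolding hausdorff_content_def by (intro INF_lower) auto
    also have "\<dots> = (\<Sum>n. \<Sum>k. hausdorff_weight s (f (n, k)))"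
      unfolding U_def
      by (rule suminf_ennreal_2dimen[of _ "\<lambda>p. hausdorff_weight s (f p)", unfolded o_def]) simp
    also have "\<dots> \<le> (\<Sum>n. ennreal (F (n + M)))"
      by (rule suminf_le) (use weight in auto)
    also have "\<dots> = ennreal (\<Sum>n. F (n + M))"
      by (rule suminf_ennreal2) (use Fnn sumM in auto)
    also have "\<dots> \<le> ennreal \<epsilon>"
      using tail by (intro ennreal_leI) simp
    finally show ?thesis by simp
  qed
  have "hausdorff_content s \<delta> A = 0" if "\<delta> > 0" for \<delta>
  proof -
    have "hausdorff_content s \<delta> A \<le> 0"
      by (rule ennreal_le_epsilon) (use content[OF that] in auto)
    then show ?thesis by simp
  qed
  then show ?thesis
    unfolding hausdorff_measure_def by (auto intro!: antisym SUP_least)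
qed

text \<open>On the unit interval the parametrisation stretches lengths by at most
  \<open>1 + \<bar>x + y\<bar> \<le> 3\<close>, and two points of a ball of radius \<open>r\<close>
  are at most \<open>2 * r\<close> apart.\<close>

lemma diameter_parabola_arc_le:
  assumes "0 \<le> r"
  shows "bounded ((\<lambda>x::real. vector [x, x\<^sup>2] :: real^2) ` (cball z r \<inter> {0..1}))" (is "bounded ?U")
    and "diameter ((\<lambda>x::real. vector [x, x\<^sup>2] :: real^2) ` (cball z r \<inter> {0..1})) \<le> 6 * r"
proof -
  have d: "dist u v \<le> 6 * r" if uv: "u \<in> ?U" "v \<in> ?U" for u v
  proof -
    obtain x y where x: "u = vector [x, x\<^sup>2]" "\<bar>x - z\<bar> \<le> r" "0 \<le> x" "x \<le> 1"
      and y: "v = vector [y, y\<^sup>2]" "\<bar>y - z\<bar> \<le> r" "0 \<le> y" "y \<le> 1"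
      using uv by (auto simp: dist_real_def abs_minus_commute)
    have 1: "dist u v \<le> \<bar>x - y\<bar> + \<bar>x\<^sup>2 - y\<^sup>2\<bar>"
      using norm_le_l1_cart[of "u - v"] by (simp add: dist_norm sum_2 x y)
    have "\<bar>x\<^sup>2 - y\<^sup>2\<bar> = \<bar>x - y\<bar> * \<bar>x + y\<bar>"
      by (simp add: power2_eq_square square_diff_square_factored abs_mult)
    also have "\<dots> \<le> \<bar>x - y\<bar> * 2"
      using x y by (intro mult_left_mono) auto
    finally have "dist u v \<le> \<bar>x - y\<bar> + \<bar>x - y\<bar> * 2"
      by (rule order_trans[OF 1 add_left_mono])
    moreover have "\<bar>x - y\<bar> \<le> 2 * r" using x(2) y(2) by linarith
    ultimately show ?thesis by (smt (verit))
  qed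
  show "bounded ?U"
    unfolding bounded_two_points using d by blast
  show "diameter ?U \<le> 6 * r"
    by (rule diameter_le) (use d assms in \<open>auto simp: dist_norm\<close>)
qed

text \<open>Covers of the parameter interval turn into covers of arcs at the cost of the constant
  factor \<open>6 powr s\<close>, so from here on it suffices to cover subsets of the line.\<close>

lemma hausdorff_measure_parabola_limsup_null:
  fixes B :: "nat \<Rightarrow> real set" and z r :: "nat \<Rightarrow> 'i \<Rightarrow> real"
  assumes s: "0 < s" and F: "summable F"
    and J: "\<And>n. n \<ge> N \<Longrightarrow> finite (J n)"
    and r: "\<And>n j. n \<ge> N \<Longrightarrow> j \<in> J n \<Longrightarrow> 0 \<le> r n j"
    and B: "\<And>n. n \<ge> N \<Longrightarrow> B n \<inter> {0..1} \<subseteq> (\<Union>j\<in>J n. cball (z n j) (r n j))"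
    and le: "\<And>n. n \<ge> N \<Longrightarrow> (\<Sum>j\<in>J n. r n j powr s) \<le> F n"
    and A: "A \<subseteq> (\<lambda>x::real. vector [x, x\<^sup>2] :: real^2) ` {x\<in>{0..1}. infinite {n. x \<in> B n}}"
      (is "A \<subseteq> ?P ` ?L")
  shows "hausdorff_measure s A = 0"
proof (rule hausdorff_measure_limsup_null[OF s, where E = "\<lambda>n. ?P ` (B n \<inter> {0..1})"
      and F = "\<lambda>n. 6 powr s * F n" and N = N])
  show "summable (\<lambda>n. 6 powr s * F n)" using F by (rule summable_mult)
  fix n assume n: "n \<ge> N"
  define V where "V j = ?P ` (cball (z n j) (r n j) \<inter> {0..1})" for j
  \<comment> \<open>Different indices may give the same arc; merging them can only decrease the
    sum.\<close>
  have "(\<Sum>U\<in>V ` J n. diameter U powr s) \<le> (\<Sum>j\<in>J n. diameter (V j) powr s)"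
    using sum_image_le[OF J[OF n], of "\<lambda>U. diameter U powr s" V] by (simp add: o_def)
  also have "\<dots> \<le> (\<Sum>j\<in>J n. (6 * r n j) powr s)"
    using diameter_parabola_arc_le[OF r[OF n]] s
    by (intro sum_mono powr_mono2) (auto simp: V_def intro!: diameter_ge_0)
  also have "\<dots> = 6 powr s * (\<Sum>j\<in>J n. r n j powr s)"
    unfolding sum_distrib_left by (rule sum.cong) (auto simp: powr_mult r[OF n])
  also have "\<dots> \<le> 6 powr s * F n"
    using le[OF n] by (intro mult_left_mono) auto
  finally have "(\<Sum>U\<in>V ` J n. diameter U powr s) \<le> 6 powr s * F n" .
  moreover have "?P ` (B n \<inter> {0..1}) \<subseteq> \<Union>(V ` J n)"
    using B[OF n] unfolding V_def by blast
  ultimately show "\<exists>\<F>. finite \<F> \<and> ?P ` (B n \<inter> {0..1}) \<subseteq> \<Union>\<F> \<and> (\<forall>U\<in>\<F>. bounded U) \<and>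
                  (\<Sum>U\<in>\<F>. diameter U powr s) \<le> 6 powr s * F n"
    using J[OF n] diameter_parabola_arc_le(1)[OF r[OF n]]
    by (intro exI[of _ "V ` J n"]) (auto simp: V_def)
next
  fix u assume "u \<in> A"
  then obtain x where x: "u = ?P x" "x \<in> {0..1}" "infinite {n. x \<in> B n}" using A by auto
  have "{n. x \<in> B n} \<subseteq> {n. u \<in> ?P ` (B n \<inter> {0..1})}" using x by auto
  then show "infinite {n. u \<in> ?P ` (B n \<inter> {0..1})}" using x(3) finite_subset by blast
qed

section \<open>Divisors and square parts\<close>

text \<open>A divisor is determined by its exponents at the primes dividing \<open>n\<close>;
  injectivity of this encoding is enough for an upper bound.\<close>

lemma card_divisors_le:
  fixes n :: nat
  assumes "n > 0"
  shows "card {d. d dvd n} \<le> (\<Prod>p\<in>prime_factors n. multiplicity p n + 1)"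
proof -
  define f where "f d = restrict (\<lambda>p. multiplicity p d) (prime_factors n)" for d
  have "card {d. d dvd n} \<le> card (\<Pi>\<^sub>E p\<in>prime_factors n. {0..multiplicity p n})"
  proof (rule card_inj_on_le[where f = f])
    show "inj_on f {d. d dvd n}"
    proof (rule inj_onI, clarify)
      fix d e assume d: "d dvd n" and e: "e dvd n" and eq: "f d = f e"
      have "multiplicity p d = multiplicity p e" if p: "prime p" for p
      proof (cases "p \<in> prime_factors n")
        case True
        then show ?thesis using fun_cong[OF eq, of p] by (simp add: f_def)
      next
        case False
        then have "\<not> p dvd d" "\<not> p dvd e"
          using p d e assms by (auto simp: in_prime_factors_iff dest: dvd_trans)
        then show ?thesis by (simp add: not_dvd_imp_multiplicity_0)
      qed
      then show "d = e"
        by (rule multiplicity_eq_nat[OF dvd_pos_nat[OF assms d] dvd_pos_nat[OF assms e]])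
    qed
    show "f ` {d. d dvd n} \<subseteq> (\<Pi>\<^sub>E p\<in>prime_factors n. {0..multiplicity p n})"
      using assms by (auto simp: f_def intro!: dvd_imp_multiplicity_le)
  qed (simp add: finite_PiE)
  also have "\<dots> = (\<Prod>p\<in>prime_factors n. multiplicity p n + 1)"
    by (simp add: card_PiE)
  finally show ?thesis .
qed

text \<open>The threshold \<open>64 = 2\<^sup>6\<close> is where \<open>p powr (k / 6)\<close> reaches \<open>2\<^sup>k\<close>.\<close>

lemma Suc_le_prime_powr:
  fixes p k :: nat
  assumes "p \<ge> 2"
  shows "real k + 1 \<le> (if p < 64 then 12 else 1) * real p powr (real k / 6)"
proof (cases "p < 64")
  case True
  \<comment> \<open>From \<open>1 + y \<le> exp y\<close> and \<open>ln 2 \<ge> 1/2\<close> comes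
    \<open>1 + k / 12 \<le> 2 powr (k / 6)\<close>. Multiplying by 12 gives more than
    \<open>k + 1\<close>, whence the constant 12.\<close>
  have "1 + real k / 12 \<le> 1 + (real k / 6) * ln 2"
    using ln2_ge_two_thirds by (simp add: field_simps mult_left_mono)
  also have "\<dots> \<le> exp ((real k / 6) * ln 2)" by (rule exp_ge_add_one_self)
  also have "\<dots> = 2 powr (real k / 6)" by (simp add: powr_def)
  also have "\<dots> \<le> real p powr (real k / 6)"
    by (rule powr_mono2) (use assms in auto)
  finally show ?thesis using True by simp
next
  case False
  have "real k + 1 \<le> 2 ^ k"
    using Suc_le_eq[THEN iffD2, OF less_exp[of k]]
    by (metis Suc_eq_plus1 of_nat_Suc of_nat_le_iff of_nat_numeral of_nat_power add.commute)
  also have "(2::real) ^ k = (2 powr 6) powr (real k / 6)"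
    by (simp only: powr_powr) (simp add: powr_realpow)
  also have "\<dots> = 64 powr (real k / 6)" by simp
  also have "\<dots> \<le> real p powr (real k / 6)"
    by (rule powr_mono2) (use False in auto)
  finally show ?thesis using False by simp
qed

text \<open>Each prime below 64 costs a factor 12, and there are at most 64 of them. The exponent
  1/6 is chosen for use at \<open>n\<^sup>2\<close>: the bound becomes a multiple of
  \<open>n powr (1/3)\<close>, whose square over \<open>n\<^sup>2\<close> is summable.\<close>

lemma card_divisors_le_powr:
  fixes n :: nat
  assumes "n > 0"
  shows "real (card {d. d dvd n}) \<le> 12 ^ 64 * real n powr (1/6)"
proof -
  have "real (card {d. d dvd n}) \<le> (\<Prod>p\<in>prime_factors n. real (multiplicity p n) + 1)"
    using of_nat_mono[OF card_divisors_le[OF assms], where 'a = real] by (simp add: add.commute)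
  also have "\<dots> \<le> (\<Prod>p\<in>prime_factors n. (if p < 64 then 12 else 1) * real p powr (real (multiplicity p n) / 6))"
  proof (rule prod_mono)
    fix p assume "p \<in> prime_factors n"
    then have "p \<ge> 2" by (simp add: in_prime_factors_iff prime_ge_2_nat)
    then show "0 \<le> real (multiplicity p n) + 1 \<and> real (multiplicity p n) + 1
        \<le> (if p < 64 then 12 else 1) * real p powr (real (multiplicity p n) / 6)"
      using Suc_le_prime_powr[of p "multiplicity p n"] by simp
  qed
  also have "\<dots> = (\<Prod>p\<in>prime_factors n. if p < 64 then 12 else 1) *
                   (\<Prod>p\<in>prime_factors n. real p powr (real (multiplicity p n) / 6))"
    by (rule prod.distrib)
  also have "(\<Prod>p\<in>prime_factors n. real p powr (real (multiplicity p n) / 6)) =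
             (\<Prod>p\<in>prime_factors n. (real p ^ multiplicity p n) powr (1/6))"
    by (rule prod.cong) (auto simp: in_prime_factors_iff prime_gt_0_nat powr_powr simp flip: powr_realpow)
  also have "\<dots> = (\<Prod>p\<in>prime_factors n. real p ^ multiplicity p n) powr (1/6)"
    by (simp add: prod_powr_distrib)
  also have "(\<Prod>p\<in>prime_factors n. real p ^ multiplicity p n) = real n"
    using prime_factorization_nat[OF assms] by (metis (no_types, lifting) of_nat_power of_nat_prod prod.cong)
  also have "(\<Prod>p\<in>prime_factors n. if p < 64 then 12 else (1::real)) = (\<Prod>p\<in>prime_factors n \<inter> {..<64}. 12)"
    by (subst prod.inter_restrict) auto
  also have "\<dots> = 12 ^ card (prime_factors n \<inter> {..<64})" by simp
  also have "\<dots> \<le> 12 ^ 64"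
    using card_mono[of "{..<64::nat}" "prime_factors n \<inter> {..<64}"] by (intro power_increasing) auto
  finally show ?thesis by (simp add: mult_right_mono)
qed

text \<open>At each prime the exponent of \<open>a\<close> is at least half that of
  \<open>n\<close>, rounded up. The rounded half is the remainder mod 2, from the squarefree part,
  plus the quotient by 2, from the square part.\<close>

lemma squarefree_part_times_square_part_dvd:
  fixes a n :: nat
  assumes "n dvd a\<^sup>2"
  shows "squarefree_part n * square_part n dvd a"
proof (cases "a = 0")
  case False
  then have n: "n \<noteq> 0" using assms by (metis dvd_0_left power_not_zero)
  show ?thesis
  proof (rule multiplicity_le_imp_dvd)
    fix p :: nat assume p: "prime p"
    have "multiplicity p n \<le> 2 * multiplicity p a"
      using dvd_imp_multiplicity_le[OF assms, of p] False p
      by (simp add: prime_elem_multiplicity_power_distrib)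
    then have "multiplicity p n mod 2 + multiplicity p n div 2 \<le> multiplicity p a"
      by presburger
    then show "multiplicity p (squarefree_part n * square_part n) \<le> multiplicity p a"
      using n p by (simp add: prime_elem_multiplicity_mult_distrib
          prime_multiplicity_square_part prime_multiplicity_squarefree_part)
  qed (use n in simp)
qed auto

text \<open>With \<open>n = k * m\<^sup>2\<close> and \<open>k\<close> squarefree, the term is
  \<open>1 / (k\<^sup>2 * m\<^sup>2)\<close>. As \<open>n\<close> determines \<open>(k, m)\<close>
  injectively, the sum is at most the square of the sum of all \<open>1 / k\<^sup>2\<close>.\<close>

lemma summable_square_part_over_self: "summable (\<lambda>n::nat. (real (square_part n))\<^sup>2 / (real n)\<^sup>2)"
proof (rule bounded_imp_summable)
  let ?Z = "\<Sum>k::nat. 1 / (real k)\<^sup>2"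
  let ?h = "\<lambda>k::nat. 1 / (real k)\<^sup>2"
  have Z: "summable ?h" using inverse_power_summable[of 2, where 'a = real] by (simp add: field_simps)
  fix N :: nat
  define g where "g n = (squarefree_part n, square_part n)" for n :: nat
  have inj: "inj_on g S" for S
    unfolding g_def by (rule inj_onI) (metis prod.inject squarefree_decompose)
  have le: "squarefree_part n \<le> n \<and> square_part n \<le> n" if "n > 0" for n :: nat
    using that squarefree_decompose[of n]
    by (metis dvd_imp_le dvd_triv_left dvd_triv_right dvd_trans power2_eq_square)
  then have sub: "g ` {1..N} \<subseteq> {..N} \<times> {..N}"
  proof (intro subsetI, elim imageE)
    fix x n assume "x = g n" "n \<in> {1..N}"
    then show "x \<in> {..N} \<times> {..N}"
      using le[of n] by (auto simp: g_def)
  qed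
  have "(\<Sum>n\<le>N. (real (square_part n))\<^sup>2 / (real n)\<^sup>2) = (\<Sum>n\<in>{1..N}. (real (square_part n))\<^sup>2 / (real n)\<^sup>2)"
    by (rule sum.mono_neutral_right) auto
  also have "\<dots> = (\<Sum>n\<in>{1..N}. (\<lambda>(k, m). ?h k * ?h m) (g n))"
  proof (rule sum.cong)
    fix n assume "n \<in> {1..N}"
    then have "square_part n \<noteq> 0" by auto
    moreover have "real n = real (squarefree_part n) * (real (square_part n))\<^sup>2"
      using squarefree_decompose[of n] by (metis of_nat_mult of_nat_power)
    ultimately show "(real (square_part n))\<^sup>2 / (real n)\<^sup>2 = (\<lambda>(k, m). ?h k * ?h m) (g n)"
      by (simp add: g_def field_simps power2_eq_square)
  qed simp
  also have "\<dots> = (\<Sum>x\<in>g ` {1..N}. (\<lambda>(k, m). ?h k * ?h m) x)"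
    by (rule sum.reindex[OF inj, symmetric, unfolded o_def])
  also have "\<dots> \<le> (\<Sum>x\<in>{..N} \<times> {..N}. (\<lambda>(k, m). ?h k * ?h m) x)"
    by (rule sum_mono2) (use sub in auto)
  also have "\<dots> = (\<Sum>k\<le>N. ?h k) * (\<Sum>k\<le>N. ?h k)"
    by (simp add: sum_product sum.cartesian_product)
  also have "\<dots> \<le> ?Z * ?Z"
    by (intro mult_mono sum_le_suminf Z sum_nonneg suminf_nonneg) auto
  finally show "(\<Sum>n\<le>N. (real (square_part n))\<^sup>2 / (real n)\<^sup>2) \<le> ?Z * ?Z" .
qed auto

section \<open>Small values of quadratic polynomials\<close>

lemma dist_nearest_int_less_imp:
  assumes "dist_nearest_int t < e"
  shows "\<exists>c::int. \<bar>t - of_int c\<bar> < e"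
proof -
  have "(INF a\<in>\<int>. dist t a) < e"
    using assms unfolding dist_nearest_int_def by (subst (asm) infdist_notempty) (auto intro: Ints_0)
  moreover have "bdd_below (dist t ` \<int>)" by (rule bdd_belowI[of _ 0]) auto
  ultimately obtain a where "a \<in> \<int>" "dist t a < e"
    by (subst (asm) cINF_less_iff) (auto intro: Ints_0)
  then show ?thesis by (auto simp: dist_real_def elim!: Ints_cases)
qed

text \<open>Intended for \<open>u\<close>, \<open>v\<close> the offsets of a point from two roots,
  \<open>B\<close> the absolute leading coefficient and \<open>M / B\<close> a lower bound for the
  root gap. One offset is at least half the gap, which forces the other to be small.\<close>

lemma abs_mult_less_imp:
  fixes u v B m M e :: real
  assumes "\<bar>u\<bar> * \<bar>v\<bar> * B < e" "M \<le> \<bar>u - v\<bar> * B" "0 < M" "0 < B" "0 \<le> e"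
  shows "\<bar>u\<bar> \<le> 2 * e / M \<or> \<bar>v\<bar> \<le> 2 * e / M"
proof (rule ccontr)
  assume "\<not> ?thesis"
  then have u: "2 * e / M < \<bar>u\<bar>" and v: "2 * e / M < \<bar>v\<bar>" by auto
  have "M \<le> (\<bar>u\<bar> + \<bar>v\<bar>) * B"
    using assms(2,4) by (smt (verit) mult_right_mono)
  then have "M / (2 * B) \<le> \<bar>u\<bar> \<or> M / (2 * B) \<le> \<bar>v\<bar>"
    using assms(4) by (auto simp: field_simps)
  moreover have "e \<le> \<bar>x\<bar> * \<bar>y\<bar> * B" if "M / (2 * B) \<le> \<bar>x\<bar>" "2 * e / M < \<bar>y\<bar>" for x y
  proof -
    have "e = M / (2 * B) * (2 * e / M) * B" using assms by simp
    also have "\<dots> \<le> \<bar>x\<bar> * \<bar>y\<bar> * B"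
      using that assms by (intro mult_right_mono mult_mono) auto
    finally show ?thesis .
  qed
  ultimately show False using u v assms(1) by (smt (verit) mult.commute)
qed

text \<open>Two real roots differ by \<open>sqrt D / \<bar>b\<bar>\<close>, and a small product of
  offsets makes one offset small. For complex roots, completing the square gives a single interval
  around the vertex; for \<open>b = 0\<close> there is one root and
  \<open>sqrt \<bar>D\<bar> = \<bar>a\<bar>\<close>.\<close>

lemma quadratic_small_values_cover:
  fixes a b c e :: real
  defines "D \<equiv> a\<^sup>2 + 4 * b * c"
  assumes D: "D \<noteq> 0" and e: "0 \<le> e"
  shows "\<exists>z w. \<forall>x. \<bar>b * x\<^sup>2 + a * x - c\<bar> < e \<longrightarrow>
           \<bar>x - z\<bar> \<le> 2 * e / sqrt \<bar>D\<bar> \<or> \<bar>x - w\<bar> \<le> 2 * e / sqrt \<bar>D\<bar>"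
proof -
  consider (linear) "b = 0" | (real) "b \<noteq> 0" "D > 0" | (complex) "b \<noteq> 0" "D < 0"
    using D by linarith
  then show ?thesis
  proof cases
    case linear
    then have a: "a \<noteq> 0" "sqrt \<bar>D\<bar> = \<bar>a\<bar>" using D by (auto simp: D_def)
    have "\<bar>x - c / a\<bar> \<le> 2 * e / sqrt \<bar>D\<bar>" if "\<bar>b * x\<^sup>2 + a * x - c\<bar> < e" for x
    proof -
      have "\<bar>a\<bar> * \<bar>x - c / a\<bar> = \<bar>b * x\<^sup>2 + a * x - c\<bar>"
        using a linear by (simp add: abs_mult[symmetric] algebra_simps)
      then have "\<bar>a\<bar> * \<bar>x - c / a\<bar> \<le> 2 * e" using that e by linarith
      then show ?thesis using a by (simp add: field_simps)
    qed
    then show ?thesis by blast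
  next
    case real
    define z where "z = (- a + sqrt D) / (2 * b)"
    define w where "w = (- a - sqrt D) / (2 * b)"
    have sq: "(sqrt D)\<^sup>2 = D" using real by simp
    have "\<bar>x - z\<bar> \<le> 2 * e / sqrt D \<or> \<bar>x - w\<bar> \<le> 2 * e / sqrt D"
      if "\<bar>b * x\<^sup>2 + a * x - c\<bar> < e" for x
    proof (rule abs_mult_less_imp[where B = "\<bar>b\<bar>"])
      have "4 * b * (b * ((x - z) * (x - w))) = (2 * b * x + a)\<^sup>2 - (sqrt D)\<^sup>2"
        using real by (simp add: z_def w_def field_simps power2_eq_square)
      also have "\<dots> = 4 * b * (b * x\<^sup>2 + a * x - c)"
        by (simp only: sq) (simp add: D_def algebra_simps power2_eq_square)
      finally have "b * ((x - z) * (x - w)) = b * x\<^sup>2 + a * x - c" using real by simp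
      then show "\<bar>x - z\<bar> * \<bar>x - w\<bar> * \<bar>b\<bar> < e" using that by (metis abs_mult mult.commute)
      have "(x - z - (x - w)) * b = - sqrt D" using real by (simp add: z_def w_def field_simps)
      then have "\<bar>x - z - (x - w)\<bar> * \<bar>b\<bar> = sqrt D"
        using real by (metis abs_minus_cancel abs_mult abs_of_pos real_sqrt_gt_zero)
      then show "sqrt D \<le> \<bar>x - z - (x - w)\<bar> * \<bar>b\<bar>" by simp
    qed (use real e in auto)
    then show ?thesis using real by auto
  next
    case complex
    define z where "z = - a / (2 * b)"
    have "\<bar>x - z\<bar> \<le> 2 * e / sqrt \<bar>D\<bar>" if x: "\<bar>b * x\<^sup>2 + a * x - c\<bar> < e" for x
    proof -
      have "4 * b * (b * x\<^sup>2 + a * x - c) = (2 * b * (x - z))\<^sup>2 + \<bar>D\<bar>"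
        using complex by (simp add: z_def D_def field_simps power2_eq_square)
      then have "4 * \<bar>b\<bar> * \<bar>b * x\<^sup>2 + a * x - c\<bar> = (2 * b * (x - z))\<^sup>2 + \<bar>D\<bar>"
        by (metis abs_mult abs_numeral abs_of_nonneg abs_ge_zero add_nonneg_nonneg zero_le_power2)
      then have le: "(2 * b * (x - z))\<^sup>2 + \<bar>D\<bar> \<le> 4 * \<bar>b\<bar> * e"
        using x by (smt (verit) abs_ge_zero mult_left_mono)
      \<comment> \<open>By \<open>le\<close> both the square and \<open>\<bar>D\<bar>\<close> are at
        most \<open>4 * \<bar>b\<bar> * e\<close>, so their product is at most the square of that
        bound.\<close>
      have "(2 * \<bar>b\<bar> * (\<bar>x - z\<bar> * sqrt \<bar>D\<bar>))\<^sup>2 = (2 * b * (x - z))\<^sup>2 * \<bar>D\<bar>"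
        by (simp add: power_mult_distrib)
      also have "\<dots> \<le> (4 * \<bar>b\<bar> * e) * (4 * \<bar>b\<bar> * e)"
        using le by (intro mult_mono) (smt (verit) zero_le_power2)+
      also have "\<dots> = (2 * \<bar>b\<bar> * (2 * e))\<^sup>2" by (simp add: power2_eq_square)
      finally have "2 * \<bar>b\<bar> * (\<bar>x - z\<bar> * sqrt \<bar>D\<bar>) \<le> 2 * \<bar>b\<bar> * (2 * e)"
        by (rule power2_le_imp_le) (use e in auto)
      then have "\<bar>x - z\<bar> * sqrt \<bar>D\<bar> \<le> 2 * e"
        using complex by (simp add: mult.commute)
      moreover have "0 < sqrt \<bar>D\<bar>" using complex by simp
      ultimately show ?thesis using pos_le_divide_eq by blast
    qed
    then show ?thesis by blast
  qed
qed

text \<open>With vanishing discriminant the polynomial is exactly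
  \<open>b * (x + a / (2 * b))\<^sup>2\<close>.\<close>

lemma quadratic_double_root_small_values:
  fixes a b c e x :: real
  assumes b: "b \<noteq> 0" and D: "a\<^sup>2 + 4 * b * c = 0" and x: "\<bar>b * x\<^sup>2 + a * x - c\<bar> < e"
  shows "\<bar>x + a / (2 * b)\<bar> \<le> sqrt (e / \<bar>b\<bar>)"
proof (rule real_le_rsqrt)
  have "4 * b * (b * x\<^sup>2 + a * x - c) = 4 * b * (b * (x + a / (2 * b))\<^sup>2) - (a\<^sup>2 + 4 * b * c)"
    using b by (simp add: field_simps power2_eq_square)
  then have "b * x\<^sup>2 + a * x - c = b * (x + a / (2 * b))\<^sup>2" using D b by simp
  then have "\<bar>b\<bar> * (x + a / (2 * b))\<^sup>2 < e" using x by (simp add: abs_mult)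
  then show "\<bar>x + a / (2 * b)\<bar>\<^sup>2 \<le> e / \<bar>b\<bar>" using b by (simp add: field_simps)
qed

section \<open>Sums over discriminants\<close>

text \<open>Telescoping: AM-GM gives
  \<open>1 / sqrt (n + 1) \<le> 2 * (sqrt (n + 1) - sqrt n)\<close>.\<close>

lemma sum_inverse_sqrt_le: "(\<Sum>i=1..n. 1 / sqrt (real i)) \<le> 2 * sqrt (real n)"
proof (induction n)
  case (Suc n)
  have "sqrt (real n) * sqrt (real n + 1) \<le> real n + 1 / 2"
    using arith_geo_mean_sqrt[of "real n" "real n + 1"] by (simp add: real_sqrt_mult)
  then have "1 \<le> 2 * (sqrt (real n + 1) - sqrt (real n)) * sqrt (real n + 1)"
    by (simp add: algebra_simps)
  then have "1 / sqrt (real n + 1) \<le> 2 * (sqrt (real n + 1) - sqrt (real n))"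
    by (simp add: field_simps)
  then show ?case using Suc by (simp add: add.commute)
qed simp

lemma sum_inverse_sqrt_int_le: "(\<Sum>i\<in>{1..int n}. 1 / sqrt (of_int i)) \<le> 2 * sqrt (real n)"
proof -
  have "(\<Sum>i\<in>{1..int n}. 1 / sqrt (of_int i)) = (\<Sum>i=1..n. 1 / sqrt (real i))"
    by (rule sum.reindex_bij_witness[of _ int nat]) auto
  then show ?thesis using sum_inverse_sqrt_le by simp
qed

text \<open>The least element \<open>l\<close> of \<open>S\<close> contributes at most 1. Every
  other \<open>c\<close> has \<open>f c \<ge> B * (c - l)\<close>, where the differences
  \<open>c - l\<close> are distinct integers between 1 and \<open>2 * M\<close>.\<close>

lemma sum_inverse_sqrt_gaps_le:
  fixes f :: "int \<Rightarrow> int" and M :: nat and B :: int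
  assumes S: "S \<subseteq> {-int M..int M}" and B: "B > 0"
    and pos: "\<And>c. c \<in> S \<Longrightarrow> f c \<ge> 1"
    and gap: "\<And>c c'. c \<in> S \<Longrightarrow> c' \<in> S \<Longrightarrow> c' \<le> c \<Longrightarrow> f c \<ge> f c' + B * (c - c')"
  shows "(\<Sum>c\<in>S. 1 / sqrt (of_int (f c))) \<le> 1 + 2 * sqrt (2 * real M) / sqrt (of_int B)"
proof (cases "S = {}")
  case False
  have fin: "finite S" using S finite_subset by blast
  define l where "l = Min S"
  have l: "l \<in> S" "\<And>c. c \<in> S \<Longrightarrow> l \<le> c" using fin False by (auto simp: l_def)
  have "(\<Sum>c\<in>S. 1 / sqrt (of_int (f c))) = 1 / sqrt (of_int (f l)) + (\<Sum>c\<in>S-{l}. 1 / sqrt (of_int (f c)))"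
    by (rule sum.remove) (use fin l in auto)
  also have "1 / sqrt (of_int (f l)) \<le> 1"
    using pos[OF l(1)] by (simp add: divide_le_eq)
  also have "(\<Sum>c\<in>S-{l}. 1 / sqrt (of_int (f c))) \<le> (\<Sum>c\<in>S-{l}. 1 / sqrt (of_int B) * (1 / sqrt (of_int (c - l))))"
  proof (rule sum_mono)
    fix c assume c: "c \<in> S - {l}"
    then have "l < c" using l(2)[of c] by auto
    have "f c \<ge> B * (c - l)" using gap[of c l] pos[of l] l c by force
    then have "sqrt (of_int B) * sqrt (of_int (c - l)) \<le> sqrt (of_int (f c))"
      by (metis of_int_le_iff of_int_mult real_sqrt_le_mono real_sqrt_mult)
    moreover have "0 < f c" using pos[of c] c by simp
    ultimately have "1 / sqrt (of_int (f c)) \<le> 1 / (sqrt (of_int B) * sqrt (of_int (c - l)))"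
      using B \<open>l < c\<close> by (intro divide_left_mono) (auto intro!: mult_pos_pos)
    then show "1 / sqrt (of_int (f c)) \<le> 1 / sqrt (of_int B) * (1 / sqrt (of_int (c - l)))" by simp
  qed
  also have "\<dots> = 1 / sqrt (of_int B) * (\<Sum>c\<in>S-{l}. 1 / sqrt (of_int (c - l)))"
    by (simp add: sum_distrib_left)
  also have "(\<Sum>c\<in>S-{l}. 1 / sqrt (of_int (c - l))) = (\<Sum>i\<in>(\<lambda>c. c - l) ` (S-{l}). 1 / sqrt (of_int i))"
    by (subst sum.reindex) (auto simp: inj_on_def)
  also have "\<dots> \<le> (\<Sum>i\<in>{1..int (2 * M)}. 1 / sqrt (of_int i))"
  proof (rule sum_mono2)
    show "(\<lambda>c. c - l) ` (S-{l}) \<subseteq> {1..int (2 * M)}"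
    proof (intro subsetI, elim imageE)
      fix i c assume "i = c - l" "c \<in> S - {l}"
      moreover from this have "c \<in> S" "l < c" using l(2)[of c] by auto
      moreover have "c \<le> int M" "- int M \<le> l" using S l(1) \<open>c \<in> S\<close> by auto
      ultimately show "i \<in> {1..int (2 * M)}" by auto
    qed
  qed auto
  also have "\<dots> \<le> 2 * sqrt (real (2 * M))" by (rule sum_inverse_sqrt_int_le)
  finally show ?thesis using B by (simp add: divide_right_mono)
qed (use B in \<open>auto intro: add_nonneg_nonneg\<close>)

lemma sum_int_symmetric:
  fixes g :: "int \<Rightarrow> 'a::comm_monoid_add"
  shows "(\<Sum>c\<in>{-m..m}. g (- c)) = (\<Sum>c\<in>{-m..m}. g c)"
  by (rule sum.reindex_bij_witness[of _ uminus uminus]) auto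

lemma sum_inverse_sqrt_progression_pos_le:
  fixes A b :: int
  assumes b: "b > 0"
  shows "(\<Sum>c\<in>{-int M..int M}. if A + 4 * b * c > 0 then 1 / sqrt (of_int (A + 4 * b * c)) else 0)
           \<le> 1 + sqrt (2 * real M) / sqrt (of_int b)"
proof -
  have "(\<Sum>c\<in>{-int M..int M}. if A + 4 * b * c > 0 then 1 / sqrt (of_int (A + 4 * b * c)) else 0) =
        (\<Sum>c\<in>{c\<in>{-int M..int M}. A + 4 * b * c > 0}. 1 / sqrt (of_int (A + 4 * b * c)))"
    by (rule sum.inter_filter[symmetric]) simp
  also have "\<dots> \<le> 1 + 2 * sqrt (2 * real M) / sqrt (of_int (4 * b))"
    \<comment> \<open>The gap is \<open>B = 4 * b\<close>; the factor \<open>sqrt 4\<close> then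
      cancels the 2 in the numerator.\<close>
    by (rule sum_inverse_sqrt_gaps_le) (use b in \<open>auto simp: algebra_simps\<close>)
  finally show ?thesis by (simp add: real_sqrt_mult)
qed

text \<open>Here and below a vanishing term of the progression contributes \<open>1 / sqrt 0 = 0\<close>.\<close>

lemma sum_inverse_sqrt_progression_le:
  fixes A b :: int
  assumes b: "b \<noteq> 0"
  shows "(\<Sum>c\<in>{-int M..int M}. 1 / sqrt \<bar>of_int (A + 4 * b * c)\<bar>)
           \<le> 2 + 2 * sqrt (2 * real M) / sqrt \<bar>of_int b\<bar>"
proof -
  have *: "(\<Sum>c\<in>{-int M..int M}. 1 / sqrt \<bar>of_int (A + 4 * b * c)\<bar>)
           \<le> 2 + 2 * sqrt (2 * real M) / sqrt (of_int b)" if b: "b > 0" for b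
  proof -
    let ?C = "{-int M..int M}"
    let ?g = "\<lambda>t::int. if t > 0 then 1 / sqrt (of_int t) else 0"
    \<comment> \<open>Negative values are treated as positive values of the negated progression;
      replacing \<open>c\<close> by \<open>- c\<close> gives it the same difference
      \<open>4 * b\<close> and the start \<open>- A\<close>.\<close>
    have g: "1 / sqrt \<bar>of_int t\<bar> = ?g t + ?g (- t)" for t :: int
      by (auto simp: abs_if)
    have "(\<Sum>c\<in>?C. 1 / sqrt \<bar>of_int (A + 4 * b * c)\<bar>) =
          (\<Sum>c\<in>?C. ?g (A + 4 * b * c) + ?g (- A + 4 * b * (- c)))"
      by (rule sum.cong[OF refl], subst g) (simp add: algebra_simps)
    also have "\<dots> = (\<Sum>c\<in>?C. ?g (A + 4 * b * c)) + (\<Sum>c\<in>?C. ?g (- A + 4 * b * (- c)))"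
      by (rule sum.distrib)
    also have "(\<Sum>c\<in>?C. ?g (- A + 4 * b * (- c))) = (\<Sum>c\<in>?C. ?g (- A + 4 * b * c))"
      by (rule sum_int_symmetric)
    finally show ?thesis
      using sum_inverse_sqrt_progression_pos_le[OF b, of A M]
        sum_inverse_sqrt_progression_pos_le[OF b, of "- A" M] by simp
  qed
  show ?thesis
  proof (cases "b > 0")
    case True
    then show ?thesis using *[of b] by simp
  next
    case False
    have "(\<Sum>c\<in>{-int M..int M}. 1 / sqrt \<bar>of_int (A + 4 * b * c)\<bar>) =
          (\<Sum>c\<in>{-int M..int M}. 1 / sqrt \<bar>of_int (A + 4 * (- b) * c)\<bar>)"
      using sum_int_symmetric[of "\<lambda>c. 1 / sqrt \<bar>of_int (A + 4 * b * c)\<bar>" "int M"] by simp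
    then show ?thesis using *[of "- b"] False b by simp
  qed
qed

section \<open>Sums over the integer vectors of a given height\<close>

definition pairs_of_height :: "nat \<Rightarrow> (int \<times> int) set" where
  "pairs_of_height n = {(a, b). max \<bar>a\<bar> \<bar>b\<bar> = int n}"

lemma pairs_of_height_subset:
  "pairs_of_height n \<subseteq> {-int n, int n} \<times> {-int n..int n} \<union> {-int n..int n} \<times> {-int n, int n}"
  by (auto simp: pairs_of_height_def max_def split: if_splits)

lemma finite_pairs_of_height [simp]: "finite (pairs_of_height n)"
  by (rule finite_subset[OF pairs_of_height_subset]) auto

text \<open>The pairs form the boundary of a square, hence lie on two pairs of opposite sides.
  Corners are counted twice, which is harmless as \<open>h\<close> is nonnegative.\<close>

lemma sum_pairs_of_height_le:
  fixes h :: "int \<Rightarrow> int \<Rightarrow> real"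
  assumes n: "n > 0" and h: "\<And>a b. 0 \<le> h a b"
  assumes A: "\<And>a. a \<in> {-int n, int n} \<Longrightarrow> (\<Sum>b\<in>{-int n..int n}. h a b) \<le> A"
    and B: "\<And>b. b \<in> {-int n, int n} \<Longrightarrow> (\<Sum>a\<in>{-int n..int n}. h a b) \<le> B"
  shows "(\<Sum>(a, b)\<in>pairs_of_height n. h a b) \<le> 2 * A + 2 * B"
proof -
  let ?E = "{-int n, int n}" and ?I = "{-int n..int n}"
  have "(\<Sum>(a, b)\<in>pairs_of_height n. h a b) \<le> (\<Sum>(a, b)\<in>?E \<times> ?I \<union> ?I \<times> ?E. h a b)"
    by (rule sum_mono2[OF _ pairs_of_height_subset]) (use h in auto)
  also have "\<dots> \<le> (\<Sum>(a, b)\<in>?E \<times> ?I. h a b) + (\<Sum>(a, b)\<in>?I \<times> ?E. h a b)"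
    using sum.union_inter[of "?E \<times> ?I" "?I \<times> ?E" "\<lambda>(a, b). h a b"]
      sum_nonneg[of "(?E \<times> ?I) \<inter> (?I \<times> ?E)" "\<lambda>(a, b). h a b"] h by (auto simp: split_def)
  also have "(\<Sum>(a, b)\<in>?E \<times> ?I. h a b) = (\<Sum>a\<in>?E. \<Sum>b\<in>?I. h a b)"
    by (simp add: sum.cartesian_product)
  also have "\<dots> \<le> (\<Sum>a\<in>?E. A)" by (rule sum_mono) (rule A)
  also have "(\<Sum>(a, b)\<in>?I \<times> ?E. h a b) = (\<Sum>b\<in>?E. \<Sum>a\<in>?I. h a b)"
    by (subst sum.swap) (simp add: sum.cartesian_product)
  also have "\<dots> \<le> (\<Sum>b\<in>?E. B)" by (rule sum_mono) (rule B)
  finally show ?thesis using n by simp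
qed

lemma card_pairs_of_height_le:
  assumes "n > 0"
  shows "real (card (pairs_of_height n)) \<le> 12 * real n"
proof -
  have "(\<Sum>(a, b)\<in>pairs_of_height n. 1) \<le> 2 * (3 * real n) + 2 * (3 * real n)"
    by (rule sum_pairs_of_height_le[OF assms]) (use assms in auto)
  then show ?thesis by (simp add: split_def)
qed

text \<open>The discriminant of \<open>b x\<^sup>2 + a x - c\<close>.\<close>

abbreviation discr :: "int \<Rightarrow> int \<Rightarrow> int \<Rightarrow> int" where
  "discr a b c \<equiv> a\<^sup>2 + 4 * b * c"

lemma sum_inverse_sqrt_abs_int_le:
  "(\<Sum>b\<in>{-int n..int n}. 1 / sqrt \<bar>of_int b\<bar>) \<le> 4 * sqrt (real n)"
proof -
  let ?g = "\<lambda>t::int. if t > 0 then 1 / sqrt (of_int t) else 0"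
  have "(\<Sum>b\<in>{-int n..int n}. 1 / sqrt \<bar>of_int b\<bar>) = (\<Sum>b\<in>{-int n..int n}. ?g b + ?g (- b))"
    by (rule sum.cong) (auto simp: abs_if)
  also have "\<dots> = 2 * (\<Sum>b\<in>{-int n..int n}. ?g b)"
    using sum_int_symmetric[of ?g "int n"] by (simp add: sum.distrib)
  also have "(\<Sum>b\<in>{-int n..int n}. ?g b) = (\<Sum>b\<in>{1..int n}. 1 / sqrt (of_int b))"
    by (rule sum.mono_neutral_cong_right) auto
  also have "\<dots> \<le> 2 * sqrt (real n)" by (rule sum_inverse_sqrt_int_le)
  finally show ?thesis by simp
qed

lemma sum_inverse_sqrt_discr_inner_le:
  assumes n: "n > 0" and ab: "(a, b) \<in> pairs_of_height n"
  shows "(\<Sum>c\<in>{-int (3 * n)..int (3 * n)}. 1 / sqrt \<bar>of_int (discr a b c)\<bar>)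
           \<le> 7 + 5 * sqrt (real n) / sqrt \<bar>of_int b\<bar>"
proof (cases "b = 0")
  case True
  \<comment> \<open>For \<open>b = 0\<close> all \<open>6 * n + 1\<close> terms equal
    \<open>1 / n\<close>, so the sum is at most 7; the second summand of the bound is 0, being a
    quotient by \<open>sqrt 0\<close>.\<close>
  then have "\<bar>a\<bar> = int n" using ab by (auto simp: pairs_of_height_def)
  then have "a\<^sup>2 = (int n)\<^sup>2" by (metis power2_abs)
  then have "sqrt \<bar>of_int (discr a b c)\<bar> = real n" for c
    using True by simp
  then show ?thesis using True n by (simp add: field_simps)
next
  case False
  \<comment> \<open>The constant 5 arises from \<open>6 \<le> (5/2)\<^sup>2\<close>.\<close>
  have "sqrt (2 * real (3 * n)) \<le> sqrt ((5/2)\<^sup>2 * real n)" by (simp add: power2_eq_square)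
  also have "\<dots> = 5 / 2 * sqrt (real n)" by (simp add: real_sqrt_mult)
  finally have "2 * sqrt (2 * real (3 * n)) / sqrt \<bar>of_int b\<bar> \<le> 5 * sqrt (real n) / sqrt \<bar>of_int b\<bar>"
    by (intro divide_right_mono) auto
  then show ?thesis using sum_inverse_sqrt_progression_le[OF False, of "a\<^sup>2" "3 * n"] by linarith
qed

lemma sum_inverse_sqrt_discr_le:
  assumes n: "n > 0"
  shows "(\<Sum>(a, b)\<in>pairs_of_height n. \<Sum>c\<in>{-int (3 * n)..int (3 * n)}. 1 / sqrt \<bar>of_int (discr a b c)\<bar>)
           \<le> 154 * real n"
proof -
  have "(\<Sum>(a, b)\<in>pairs_of_height n. \<Sum>c\<in>{-int (3 * n)..int (3 * n)}. 1 / sqrt \<bar>of_int (discr a b c)\<bar>)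
      \<le> (\<Sum>(a, b)\<in>pairs_of_height n. 7 + 5 * sqrt (real n) / sqrt \<bar>of_int b\<bar>)"
    by (rule sum_mono) (use sum_inverse_sqrt_discr_inner_le[OF n] in auto)
  \<comment> \<open>On the sides \<open>\<bar>a\<bar> = n\<close> the bound is
    \<open>7 * (2 * n + 1) + 20 * n \<le> 41 * n\<close>. On the sides
    \<open>\<bar>b\<bar> = n\<close> each of the \<open>2 * n + 1\<close> terms is 12, in total at
    most \<open>36 * n\<close>.\<close>
  also have "\<dots> \<le> 2 * (41 * real n) + 2 * (36 * real n)"
  proof (rule sum_pairs_of_height_le[OF n])
    have "(\<Sum>b\<in>{-int n..int n}. 7 + 5 * sqrt (real n) / sqrt \<bar>of_int b\<bar>) =
          7 * (2 * real n + 1) + 5 * sqrt (real n) * (\<Sum>b\<in>{-int n..int n}. 1 / sqrt \<bar>of_int b\<bar>)"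
      by (simp add: sum.distrib sum_distrib_left)
    also have "\<dots> \<le> 7 * (2 * real n + 1) + 5 * sqrt (real n) * (4 * sqrt (real n))"
      using sum_inverse_sqrt_abs_int_le[of n] by (intro add_left_mono mult_left_mono) auto
    also have "\<dots> \<le> 41 * real n" using n by simp
    finally show "(\<Sum>b\<in>{-int n..int n}. 7 + 5 * sqrt (real n) / sqrt \<bar>of_int b\<bar>) \<le> 41 * real n" .
  next
    fix b assume "b \<in> {-int n, int n}"
    then have "sqrt (real n) / sqrt \<bar>of_int b\<bar> = 1" using n by auto
    then show "(\<Sum>a\<in>{-int n..int n}. 7 + 5 * sqrt (real n) / sqrt \<bar>of_int b\<bar>) \<le> 36 * real n"
      using n by simp
  qed auto
  finally show ?thesis by simp
qed

lemma powr_le_one_plus: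
  fixes y s :: real
  assumes "0 \<le> y" "0 < s" "s \<le> 1"
  shows "y powr s \<le> 1 + y"
proof (cases "y \<le> 1")
  case True
  then have "y powr s \<le> 1" using assms powr_mono2[of s y 1] by simp
  then show ?thesis using assms by simp
next
  case False
  then have "y powr s \<le> y powr 1" using assms by (intro powr_mono) auto
  then show ?thesis using assms by simp
qed

lemma sum_inverse_sqrt_discr_powr_le:
  fixes s :: real
  assumes n: "n > 0" and s: "0 < s" "s \<le> 1"
  shows "(\<Sum>(a, b)\<in>pairs_of_height n. \<Sum>c\<in>{-int (3 * n)..int (3 * n)}. (1 / sqrt \<bar>of_int (discr a b c)\<bar>) powr s)
           \<le> 238 * real n powr (2 - s)"
proof -
  let ?C = "{-int (3 * n)..int (3 * n)}"
  \<comment> \<open>Scaling \<open>y\<close> by \<open>n\<close>, the inverse of its average size, makes the crude bound lossless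
    and reduces the sum to the exponent \<open>s = 1\<close>.\<close>
  have 1: "y powr s \<le> real n powr (- s) * (1 + real n * y)" if "0 \<le> y" for y
  proof -
    have "y powr s = real n powr (- s) * (real n * y) powr s"
      using that n by (simp add: powr_mult powr_minus)
    also have "\<dots> \<le> real n powr (- s) * (1 + real n * y)"
      using that s by (intro mult_left_mono powr_le_one_plus) auto
    finally show ?thesis .
  qed
  have 2: "(\<Sum>x\<in>P. \<Sum>c\<in>?C. k * (1 + m * g x c)) =
      k * (real (card P) * (6 * real n + 1) + m * (\<Sum>x\<in>P. \<Sum>c\<in>?C. g x c))"
    for P :: "(int \<times> int) set" and k m :: real and g
    by (simp add: sum.distrib flip: sum_distrib_left)
  have "(\<Sum>(a, b)\<in>pairs_of_height n. \<Sum>c\<in>?C. (1 / sqrt \<bar>of_int (discr a b c)\<bar>) powr s)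
      \<le> (\<Sum>(a, b)\<in>pairs_of_height n. \<Sum>c\<in>?C. real n powr (- s) * (1 + real n * (1 / sqrt \<bar>of_int (discr a b c)\<bar>)))"
    unfolding split_def by (intro sum_mono 1) auto
  also have "\<dots> = real n powr (- s) * (real (card (pairs_of_height n)) * (6 * real n + 1) +
       real n * (\<Sum>(a, b)\<in>pairs_of_height n. \<Sum>c\<in>?C. 1 / sqrt \<bar>of_int (discr a b c)\<bar>))"
    unfolding split_def by (rule 2)
  also have "\<dots> \<le> real n powr (- s) * (12 * real n * (7 * real n) + real n * (154 * real n))"
    using n card_pairs_of_height_le[OF n] sum_inverse_sqrt_discr_le[OF n]
    by (intro mult_left_mono add_mono mult_mono) auto
  also have "\<dots> = 238 * real n powr (2 - s)"
    using n by (simp add: powr_diff powr_minus field_simps power2_eq_square)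
  finally show ?thesis .
qed

section \<open>Double roots\<close>

text \<open>Such \<open>a\<close> are multiples of \<open>d = n / m\<close>, where \<open>m\<close>
  is the square part, and the multiples of \<open>d\<close> in the range are \<open>d * j\<close>
  with \<open>\<bar>j\<bar> \<le> m\<close>.\<close>

lemma card_square_multiples_le:
  assumes n: "n > 0"
  shows "card {a\<in>{-int n..int n}. int n dvd a\<^sup>2} \<le> 2 * square_part n + 1"
proof -
  define d where "d = squarefree_part n * square_part n"
  let ?m = "int (square_part n)"
  have dm: "int d * ?m = int n" and d0: "d > 0"
    using n squarefree_decompose[of n] unfolding d_def
    by (metis mult.assoc of_nat_mult power2_eq_square, metis nat_0_less_mult_iff bot_nat_0.not_eq_extremum squarefree_part_nonzero square_part_0_iff)
  have "{a\<in>{-int n..int n}. int n dvd a\<^sup>2} \<subseteq> (\<lambda>j. int d * j) ` {-?m..?m}"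
  proof clarify
    fix a assume a: "a \<in> {-int n..int n}" "int n dvd a\<^sup>2"
    then have "int n dvd int ((nat \<bar>a\<bar>)\<^sup>2)" by simp
    then have "n dvd (nat \<bar>a\<bar>)\<^sup>2" by (simp only: of_nat_dvd_iff)
    then have "d dvd nat \<bar>a\<bar>"
      unfolding d_def by (rule squarefree_part_times_square_part_dvd)
    then have "int d dvd a" by (simp add: dvd_nat_abs_iff)
    then obtain j where j: "a = int d * j" by (elim dvdE)
    have "int d * j \<le> int d * ?m" "int d * (- ?m) \<le> int d * j"
      using a(1) j dm by auto
    then have "j \<le> ?m" "- ?m \<le> j"
      using d0 by (metis mult_le_cancel_left_pos of_nat_0_less_iff)+
    then have "j \<in> {-?m..?m}" by simp
    then show "a \<in> (\<lambda>j. int d * j) ` {-?m..?m}" using j by blast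
  qed
  then have "card {a\<in>{-int n..int n}. int n dvd a\<^sup>2} \<le> card ((\<lambda>j. int d * j) ` {-?m..?m})"
    by (intro card_mono) auto
  also have "\<dots> \<le> card {-?m..?m}" by (rule card_image_le) simp
  finally show ?thesis by simp
qed

lemma card_int_divisors_le:
  fixes N :: nat
  assumes "N > 0"
  shows "finite {b. b dvd int N}" and "card {b. b dvd int N} \<le> 2 * card {d. d dvd N}"
proof -
  have sub: "{b. b dvd int N} \<subseteq> int ` {d. d dvd N} \<union> (\<lambda>d. - int d) ` {d. d dvd N}"
  proof
    fix b assume "b \<in> {b. b dvd int N}"
    then have "nat \<bar>b\<bar> dvd N" by (simp add: nat_abs_dvd_iff)
    moreover have "b = int (nat \<bar>b\<bar>) \<or> b = - int (nat \<bar>b\<bar>)" by auto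
    ultimately show "b \<in> int ` {d. d dvd N} \<union> (\<lambda>d. - int d) ` {d. d dvd N}" by blast
  qed
  have fin: "finite {d. d dvd N}" using assms by simp
  then show "finite {b. b dvd int N}" by (intro finite_subset[OF sub]) auto
  have "card {b. b dvd int N} \<le> card (int ` {d. d dvd N} \<union> (\<lambda>d. - int d) ` {d. d dvd N})"
    by (rule card_mono[OF _ sub]) (use fin in auto)
  also have "\<dots> \<le> card (int ` {d. d dvd N}) + card ((\<lambda>d. - int d) ` {d. d dvd N})"
    by (rule card_Un_le)
  also have "\<dots> \<le> card {d. d dvd N} + card {d. d dvd N}"
    by (intro add_mono card_image_le fin)
  finally show "card {b. b dvd int N} \<le> 2 * card {d. d dvd N}" by simp
qed

text \<open>The nesting \<open>((a, b), c)\<close> matches the product index set used for the cover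
  of one height.\<close>

definition double_root_triples :: "nat \<Rightarrow> ((int \<times> int) \<times> int) set" where
  "double_root_triples n =
     {((a, b), c). (a, b) \<in> pairs_of_height n \<and> c \<in> {-int (3 * n)..int (3 * n)} \<and> discr a b c = 0}"

text \<open>Since \<open>a\<^sup>2 = - 4 * b * c\<close>, \<open>b = 0\<close> would force
  \<open>a = 0\<close>. If \<open>\<bar>b\<bar>\<close> is not the height, then
  \<open>\<bar>a\<bar> = n\<close> and \<open>n\<^sup>2 = 4 * \<bar>b\<bar> * \<bar>c\<bar> \<le> 12
  * \<bar>b\<bar> * n\<close>.\<close>

lemma double_root_triples_height:
  assumes n: "n > 0" and abc: "((a, b), c) \<in> double_root_triples n"
  shows "b \<noteq> 0" and "int n \<le> 12 * \<bar>b\<bar>"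
proof -
  have ab: "max \<bar>a\<bar> \<bar>b\<bar> = int n" and c: "\<bar>c\<bar> \<le> 3 * int n" and D: "a\<^sup>2 = - (4 * b * c)"
    using abc by (auto simp: double_root_triples_def pairs_of_height_def)
  show b: "b \<noteq> 0" using ab D n by auto
  show "int n \<le> 12 * \<bar>b\<bar>"
  proof (cases "\<bar>b\<bar> = int n")
    case False
    then have "\<bar>a\<bar> = int n" using ab by linarith
    then have "int n * int n = \<bar>a\<^sup>2\<bar>" by (simp add: power2_eq_square abs_mult)
    also have "\<dots> = 4 * \<bar>b\<bar> * \<bar>c\<bar>" by (simp add: D abs_mult)
    also have "\<dots> \<le> 4 * \<bar>b\<bar> * (3 * int n)" by (rule mult_left_mono[OF c]) simp
    finally have "int n * int n \<le> (12 * \<bar>b\<bar>) * int n" by simp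
    then show ?thesis using n by simp
  qed auto
qed

text \<open>As \<open>b \<noteq> 0\<close>, the pair \<open>(a, b)\<close> determines
  \<open>c\<close>, so it suffices to count pairs with \<open>b dvd a\<^sup>2\<close>, separately
  for \<open>\<bar>b\<bar> = n\<close> and \<open>\<bar>a\<bar> = n\<close>.\<close>

lemma card_double_root_triples_le:
  assumes n: "n > 0"
  shows "card (double_root_triples n) \<le> 6 * square_part n + 4 * card {d. d dvd n\<^sup>2}"
proof -
  let ?A = "{a\<in>{-int n..int n}. int n dvd a\<^sup>2}" and ?B = "{b. b dvd int (n\<^sup>2)}" and ?E = "{-int n, int n}"
  have finB: "finite ?B" using n by (intro card_int_divisors_le(1)) simp
  have "inj_on fst (double_root_triples n)"
  proof (rule inj_onI)
    fix p q :: "(int \<times> int) \<times> int"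
    assume pq: "p \<in> double_root_triples n" "q \<in> double_root_triples n" "fst p = fst q"
    obtain a b c c' where "p = ((a, b), c)" "q = ((a, b), c')"
      using pq(3) by (metis prod.collapse)
    with pq show "p = q"
      using double_root_triples_height(1)[OF n, of a b c]
      by (auto simp: double_root_triples_def) (metis add_left_cancel mult_cancel_left mult_eq_0_iff zero_neq_numeral)
  qed
  then have "card (double_root_triples n) = card (fst ` double_root_triples n)"
    by (simp add: card_image)
  also have "\<dots> \<le> card (?A \<times> ?E \<union> ?E \<times> ?B)"
  proof (rule card_mono)
    show "fst ` double_root_triples n \<subseteq> ?A \<times> ?E \<union> ?E \<times> ?B"
    proof
      fix p assume "p \<in> fst ` double_root_triples n"
      then obtain a b c where p: "p = (a, b)" and abc: "((a, b), c) \<in> double_root_triples n" by auto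
      show "p \<in> ?A \<times> ?E \<union> ?E \<times> ?B"
      proof (rule ccontr)
        assume np: "p \<notin> ?A \<times> ?E \<union> ?E \<times> ?B"
        with abc p have ab: "max \<bar>a\<bar> \<bar>b\<bar> = int n" and D: "a\<^sup>2 = b * (- 4 * c)"
          and nE: "\<not> (a \<in> ?E \<and> b dvd int n ^ 2)"
          by (auto simp: double_root_triples_def pairs_of_height_def)
        have b: "b dvd a\<^sup>2" by (simp only: D dvd_triv_left)
        have "\<bar>a\<bar> \<noteq> int n"
        proof
          assume "\<bar>a\<bar> = int n"
          then have "a\<^sup>2 = int n ^ 2" "a \<in> ?E" by (metis power2_abs, auto)
          then show False using nE b by simp
        qed
        then have "\<bar>b\<bar> = int n" "\<bar>a\<bar> \<le> int n" using ab by linarith+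
        moreover have "int n dvd a\<^sup>2" using b \<open>\<bar>b\<bar> = int n\<close> by (metis abs_dvd_iff)
        ultimately show False using np p by auto
      qed
    qed
  next
    have "finite ?A" by (rule finite_subset[of _ "{-int n..int n}"]) auto
    then show "finite (?A \<times> ?E \<union> ?E \<times> ?B)" using finB by blast
  qed
  also have "\<dots> \<le> card (?A \<times> ?E) + card (?E \<times> ?B)" by (rule card_Un_le)
  also have "\<dots> = card ?A * 2 + 2 * card ?B" using n by (simp add: card_cartesian_product)
  also have "\<dots> \<le> (2 * square_part n + 1) * 2 + 2 * (2 * card {d. d dvd n\<^sup>2})"
    using card_square_multiples_le[OF n] card_int_divisors_le(2)[of "n\<^sup>2"] n
    by (intro add_mono mult_le_mono) auto
  \<comment> \<open>The additive 2 is absorbed because the square part of a positive number is at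
    least 1.\<close>
  also have "\<dots> \<le> 6 * square_part n + 4 * card {d. d dvd n\<^sup>2}"
    using n square_part_0_iff[of n] by (cases "square_part n") auto
  finally show ?thesis .
qed

lemma summable_card_double_root_triples:
  "summable (\<lambda>n. (real (card (double_root_triples n)))\<^sup>2 / (real n)\<^sup>2)"
proof (rule summable_comparison_test')
  define K :: real where "K = 12 ^ 64"
  \<comment> \<open>The constants come from
    \<open>(x + y)\<^sup>2 \<le> 2 * x\<^sup>2 + 2 * y\<^sup>2\<close> with coefficients 6 and 4;
    the exponent is \<open>2/3 - 2\<close>.\<close>
  show "summable (\<lambda>n. 72 * ((real (square_part n))\<^sup>2 / (real n)\<^sup>2) + 32 * K\<^sup>2 * real n powr (- 4 / 3))"
    by (intro summable_add summable_mult summable_square_part_over_self)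
       (simp add: summable_real_powr_iff)
  fix n :: nat assume "n \<ge> 1"
  then have n: "n > 0" by simp
  let ?m = "real (square_part n)" and ?t = "real (card (double_root_triples n))"
  have "?t \<le> 6 * ?m + 4 * real (card {d. d dvd n\<^sup>2})"
    using of_nat_mono[OF card_double_root_triples_le[OF n], where 'a = real] by simp
  also have "real (card {d. d dvd n\<^sup>2}) \<le> K * real (n\<^sup>2) powr (1/6)"
    unfolding K_def by (rule card_divisors_le_powr) (use n in simp)
  also have "real (n\<^sup>2) powr (1/6) = real n powr (1/3)"
    using n by (simp add: powr_powr flip: powr_numeral)
  finally have "?t \<le> 6 * ?m + 4 * (K * real n powr (1/3))" by simp
  then have "?t\<^sup>2 \<le> (6 * ?m + 4 * (K * real n powr (1/3)))\<^sup>2" by (intro power_mono) auto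
  also have "\<dots> \<le> 2 * (6 * ?m)\<^sup>2 + 2 * (4 * (K * real n powr (1/3)))\<^sup>2"
    using sum_squares_bound[of "6 * ?m" "4 * (K * real n powr (1/3))"] by (simp only: power2_sum)
  also have "\<dots> = 72 * ?m\<^sup>2 + 32 * K\<^sup>2 * (real n powr (1/3))\<^sup>2"
    by (simp add: power_mult_distrib)
  finally have "?t\<^sup>2 / (real n)\<^sup>2 \<le> (72 * ?m\<^sup>2 + 32 * K\<^sup>2 * (real n powr (1/3))\<^sup>2) / (real n)\<^sup>2"
    by (rule divide_right_mono) simp
  also have "\<dots> = 72 * (?m\<^sup>2 / (real n)\<^sup>2) + 32 * K\<^sup>2 * ((real n powr (1/3))\<^sup>2 / (real n)\<^sup>2)"
    by (simp add: add_divide_distrib)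
  also have "(real n powr (1/3))\<^sup>2 / (real n)\<^sup>2 = real n powr (- 4 / 3)"
    using n by (simp add: powr_powr powr_diff[symmetric] flip: powr_numeral)
  finally show "norm (?t\<^sup>2 / (real n)\<^sup>2) \<le> 72 * (?m\<^sup>2 / (real n)\<^sup>2) + 32 * K\<^sup>2 * real n powr (- 4 / 3)"
    by simp
qed

section \<open>Covering one height level\<close>

text \<open>The boolean in \<open>J\<close> selects one of two centres belonging to a triple; both
  carry the same radius. Nonzero discriminants are handled by the sum over discriminants, zero ones
  by counting.\<close>

lemma height_level_cover:
  fixes s e :: real
  assumes n: "n > 0" and s: "0 < s" "s \<le> 1" and e: "0 \<le> e" "e \<le> 1"
  defines "J \<equiv> (pairs_of_height n \<times> {-int (3 * n)..int (3 * n)}) \<times> (UNIV :: bool set)"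
  shows "\<exists>z r. (\<forall>j. 0 \<le> r j) \<and>
           {x. \<exists>a b c. (a, b) \<in> pairs_of_height n \<and> \<bar>of_int b * x\<^sup>2 + of_int a * x - of_int c\<bar> < e} \<inter> {0..1}
             \<subseteq> (\<Union>j\<in>J. cball (z j) (r j)) \<and>
           (\<Sum>j\<in>J. r j powr s) \<le> 976 * (e powr s * real n powr (2 - s)) +
             24 * ((real (card (double_root_triples n)))\<^sup>2 / (real n)\<^sup>2)"
proof -
  let ?C = "{-int (3 * n)..int (3 * n)}"
  define \<rho> where "\<rho> = (\<lambda>((a, b), c). if discr a b c = 0 then sqrt (e / \<bar>of_int b\<bar>)
                        else 2 * e / sqrt \<bar>of_int (discr a b c)\<bar>)"
  have \<rho>: "0 \<le> \<rho> p" for p using e by (auto simp: \<rho>_def split: prod.split)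
  have "\<exists>y w. \<forall>x. \<bar>of_int b * x\<^sup>2 + of_int a * x - of_int c\<bar> < e \<longrightarrow>
          \<bar>x - y\<bar> \<le> \<rho> ((a, b), c) \<or> \<bar>x - w\<bar> \<le> \<rho> ((a, b), c)"
    if ab: "(a, b) \<in> pairs_of_height n" for a b c
  proof (cases "discr a b c = 0")
    case True
    then have "of_int (discr a b c) = (0::real)" by (simp only: of_int_0)
    then have "(of_int a)\<^sup>2 + 4 * of_int b * of_int c = (0::real)" by simp
    moreover have "b \<noteq> 0"
    proof
      assume "b = 0"
      with True have "a = 0" by simp
      then show False using ab n \<open>b = 0\<close> by (simp add: pairs_of_height_def)
    qed
    ultimately have "\<bar>x - (- of_int a / (2 * of_int b))\<bar> \<le> \<rho> ((a, b), c)"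
      if "\<bar>of_int b * x\<^sup>2 + of_int a * x - of_int c\<bar> < e" for x
      using quadratic_double_root_small_values[of "of_int b" "of_int a" "of_int c" x e] that True
      by (simp add: \<rho>_def)
    then show ?thesis by blast
  next
    case False
    then have "of_int (discr a b c) \<noteq> (0::real)" by (simp only: of_int_eq_0_iff not_False_eq_True)
    then have "(of_int a)\<^sup>2 + 4 * of_int b * of_int c \<noteq> (0::real)" by simp
    then show ?thesis
      using quadratic_small_values_cover[of "of_int a" "of_int b" "of_int c" e] False e
      by (simp add: \<rho>_def)
  qed
  then have "\<forall>a b c. \<exists>y w. (a, b) \<in> pairs_of_height n \<longrightarrow>
      (\<forall>x. \<bar>of_int b * x\<^sup>2 + of_int a * x - of_int c\<bar> < e \<longrightarrow>
          \<bar>x - y\<bar> \<le> \<rho> ((a, b), c) \<or> \<bar>x - w\<bar> \<le> \<rho> ((a, b), c))"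
    by blast
  then obtain y w where yw: "\<And>a b c x. (a, b) \<in> pairs_of_height n \<Longrightarrow>
      \<bar>of_int b * x\<^sup>2 + of_int a * x - of_int c\<bar> < e \<Longrightarrow>
      \<bar>x - y a b c\<bar> \<le> \<rho> ((a, b), c) \<or> \<bar>x - w a b c\<bar> \<le> \<rho> ((a, b), c)"
    unfolding choice_iff by blast
  define z where "z = (\<lambda>(((a, b), c), v). if v then y a b c else w a b c)"
  have cover: "x \<in> (\<Union>j\<in>J. cball (z j) (\<rho> (fst j)))"
    if x: "0 \<le> x" "x \<le> 1" and ab: "(a, b) \<in> pairs_of_height n"
      and lt: "\<bar>of_int b * x\<^sup>2 + of_int a * x - of_int c\<bar> < e" for x a b c
  proof -
    have "\<bar>of_int b * x\<^sup>2\<bar> \<le> real n * 1" "\<bar>of_int a * x\<bar> \<le> real n * 1"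
      unfolding abs_mult using ab x
      by (intro mult_mono; force simp: pairs_of_height_def power_le_one)+
    \<comment> \<open>This is where \<open>e \<le> 1\<close> enters:
      \<open>2 * n + 1 \<le> 3 * n\<close> fixes the range of \<open>c\<close> in
      \<open>J\<close>.\<close>
    then have "\<bar>of_int c\<bar> \<le> 2 * real n + 1" using lt e by linarith
    then have "c \<in> ?C" using n by auto
    then have "(((a, b), c), v) \<in> J" for v using ab by (simp add: J_def)
    moreover from yw[OF ab lt] have "\<exists>v. x \<in> cball (z (((a, b), c), v)) (\<rho> ((a, b), c))"
      by (auto simp: z_def dist_real_def abs_minus_commute intro: exI[of _ True] exI[of _ False])
    ultimately show ?thesis by force
  qed
  define E where "E = e powr s * real n powr (2 - s)"
  define t where "t = real (card (double_root_triples n))"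
  define q where "q = (12 * e / real n) powr (s / 2)"
  \<comment> \<open>For a zero discriminant the first summand is 0 since
    \<open>1 / sqrt 0 = 0\<close>, and \<open>q\<close> comes from
    \<open>\<bar>b\<bar> \<ge> n / 12\<close>; otherwise the second summand is 0.\<close>
  have \<rho>_le: "\<rho> ((a, b), c) powr s \<le> 2 * e powr s * (1 / sqrt \<bar>of_int (discr a b c)\<bar>) powr s +
                 (if ((a, b), c) \<in> double_root_triples n then q else 0)"
    if abc: "(a, b) \<in> pairs_of_height n" "c \<in> ?C" for a b c
  proof (cases "discr a b c = 0")
    case True
    then have Z: "((a, b), c) \<in> double_root_triples n" using abc by (simp add: double_root_triples_def)
    note b = double_root_triples_height[OF n Z]
    have "real n \<le> 12 * \<bar>of_int b\<bar>" using b(2) by linarith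
    then have "e / \<bar>of_int b\<bar> \<le> 12 * e / real n"
      using e n b(1) by (simp add: field_simps mult_left_mono)
    then have "(e / \<bar>of_int b\<bar>) powr (s / 2) \<le> q"
      unfolding q_def using s e by (intro powr_mono2) auto
    then show ?thesis using True Z e by (simp add: \<rho>_def powr_half_sqrt[symmetric] powr_powr)
  next
    case False
    have "\<rho> ((a, b), c) powr s = 2 powr s * e powr s * (1 / sqrt \<bar>of_int (discr a b c)\<bar>) powr s"
      using False e by (simp add: \<rho>_def powr_mult[symmetric])
    also have "\<dots> \<le> 2 * e powr s * (1 / sqrt \<bar>of_int (discr a b c)\<bar>) powr s"
      using s powr_mono[of s 1 2] by (intro mult_right_mono) auto
    finally show ?thesis using False by (simp add: double_root_triples_def)
  qed
  have double: "(\<Sum>j\<in>P \<times> (UNIV :: bool set). f (fst j)) = 2 * (\<Sum>p\<in>P. f p)"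
    for P :: "((int \<times> int) \<times> int) set" and f :: "_ \<Rightarrow> real"
  proof -
    have "(\<Sum>j\<in>P \<times> (UNIV :: bool set). f (fst j)) = (\<Sum>p\<in>P. \<Sum>v\<in>(UNIV :: bool set). f p)"
      by (simp only: sum.cartesian_product split_def)
    then show ?thesis by (simp add: UNIV_bool sum_distrib_left)
  qed
  define P where "P = pairs_of_height n \<times> ?C"
  define g where "g = (\<lambda>((a, b), c). (1 / sqrt \<bar>of_int (discr a b c)\<bar>) powr s)"
  have "finite P" by (simp add: P_def)
  have "(\<Sum>j\<in>J. \<rho> (fst j) powr s) = 2 * (\<Sum>p\<in>P. \<rho> p powr s)"
    unfolding J_def P_def by (rule double)
  also have "(\<Sum>p\<in>P. \<rho> p powr s) \<le>
      (\<Sum>p\<in>P. 2 * e powr s * g p + (if p \<in> double_root_triples n then q else 0))"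
  proof (rule sum_mono)
    fix p assume "p \<in> P"
    moreover obtain a b c where "p = ((a, b), c)" by (metis prod.collapse)
    ultimately show "\<rho> p powr s \<le> 2 * e powr s * g p + (if p \<in> double_root_triples n then q else 0)"
      using \<rho>_le[of a b c] by (simp add: P_def g_def)
  qed
  also have "\<dots> = 2 * e powr s * (\<Sum>p\<in>P. g p) + (\<Sum>p\<in>P. if p \<in> double_root_triples n then q else 0)"
    by (simp only: sum.distrib sum_distrib_left)
  also have "(\<Sum>p\<in>P. if p \<in> double_root_triples n then q else 0) = t * q"
  proof -
    have "P \<inter> double_root_triples n = double_root_triples n"
      by (auto simp: double_root_triples_def P_def)
    then show ?thesis
      using sum.inter_restrict[OF \<open>finite P\<close>, of "\<lambda>_. q" "double_root_triples n"] by (simp add: t_def)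
  qed
  finally have 1: "(\<Sum>j\<in>J. \<rho> (fst j) powr s) \<le> 2 * (2 * e powr s * (\<Sum>p\<in>P. g p) + t * q)" by simp
  have "(\<Sum>p\<in>P. g p) = (\<Sum>(a, b)\<in>pairs_of_height n. \<Sum>c\<in>?C. (1 / sqrt \<bar>of_int (discr a b c)\<bar>) powr s)"
    unfolding P_def g_def by (simp only: sum.cartesian_product split_def)
  also have "\<dots> \<le> 238 * real n powr (2 - s)"
    by (rule sum_inverse_sqrt_discr_powr_le[OF n s])
  finally have "e powr s * (\<Sum>p\<in>P. g p) \<le> e powr s * (238 * real n powr (2 - s))"
    by (rule mult_left_mono) simp
  then have 2: "e powr s * (\<Sum>p\<in>P. g p) \<le> 238 * E" by (simp add: E_def)
  have 3: "t * q \<le> 12 * (E + t\<^sup>2 / (real n)\<^sup>2)"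
  proof -
    \<comment> \<open>Since \<open>(e / n) powr s * n\<^sup>2 = E\<close>, the product
      \<open>v * n\<close> is \<open>sqrt E\<close>, and AM-GM applies to
      \<open>t * v = sqrt E * (t / n)\<close>.\<close>
    define v where "v = (e / real n) powr (s / 2)"
    have "v\<^sup>2 = (e / real n) powr s"
      unfolding v_def power2_eq_square by (simp flip: powr_add)
    then have "(v * real n)\<^sup>2 = E"
      using e n by (simp add: E_def power_mult_distrib powr_divide powr_diff)
    then have v: "v * real n = sqrt E"
      by (metis real_sqrt_unique v_def powr_ge_zero mult_nonneg_nonneg of_nat_0_le_iff)
    have "q = 12 powr (s / 2) * v"
      using e n unfolding q_def v_def by (simp add: powr_mult[symmetric])
    also have "\<dots> \<le> 12 powr 1 * v"
      using s by (intro mult_right_mono powr_mono) (auto simp: v_def)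
    finally have "t * q \<le> t * (12 * v)" by (intro mult_left_mono) (auto simp: t_def)
    also have "\<dots> = 12 * (sqrt E * (t / real n))" using n by (simp flip: v)
    also have "\<dots> \<le> 12 * ((sqrt E)\<^sup>2 + (t / real n)\<^sup>2)"
    proof (rule mult_left_mono)
      have "2 * (sqrt E * (t / real n)) \<le> (sqrt E)\<^sup>2 + (t / real n)\<^sup>2"
        using sum_squares_bound[of "sqrt E" "t / real n"] by (simp only: mult.assoc)
      moreover have "0 \<le> sqrt E * (t / real n)" by (simp add: E_def t_def)
      ultimately show "sqrt E * (t / real n) \<le> (sqrt E)\<^sup>2 + (t / real n)\<^sup>2" by linarith
    qed simp
    finally show ?thesis by (simp add: power_divide E_def)
  qed
  \<comment> \<open>\<open>976 = 2 * (2 * 238 + 12)\<close> and \<open>24 = 2 * 12\<close>, the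
    outer 2 counting the centres.\<close>
  have "(\<Sum>j\<in>J. \<rho> (fst j) powr s) \<le> 976 * E + 24 * (t\<^sup>2 / (real n)\<^sup>2)"
    using 1 2 3 by argo
  moreover have "{x. \<exists>a b c. (a, b) \<in> pairs_of_height n \<and> \<bar>of_int b * x\<^sup>2 + of_int a * x - of_int c\<bar> < e} \<inter> {0..1}
      \<subseteq> (\<Union>j\<in>J. cball (z j) (\<rho> (fst j)))"
  proof
    fix x assume "x \<in> {x. \<exists>a b c. (a, b) \<in> pairs_of_height n \<and> \<bar>of_int b * x\<^sup>2 + of_int a * x - of_int c\<bar> < e} \<inter> {0..1}"
    then obtain a b c where "0 \<le> x" "x \<le> 1" "(a, b) \<in> pairs_of_height n"
        "\<bar>of_int b * x\<^sup>2 + of_int a * x - of_int c\<bar> < e"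
      by auto
    then show "x \<in> (\<Union>j\<in>J. cball (z j) (\<rho> (fst j)))" by (rule cover)
  qed
  ultimately show ?thesis
    using \<rho> unfolding E_def t_def by (intro exI[of _ z] exI[of _ "\<lambda>j. \<rho> (fst j)"] conjI allI)
qed

section \<open>From single heights to the limsup set\<close>

lemma finite_max_norm: "finite {q. max_norm q = n}"
proof (rule finite_imageD)
  let ?f = "\<lambda>q :: int^2. (q $ 1, q $ 2)"
  show "finite (?f ` {q. max_norm q = n})"
    by (rule finite_subset[OF _ finite_pairs_of_height[of n]])
       (auto simp: max_norm_def pairs_of_height_def)
  show "inj_on ?f {q. max_norm q = n}"
    by (auto simp: inj_on_def vec_eq_iff forall_2)
qed

theorem theorem3:
  fixes s :: real and \<psi> :: "nat \<Rightarrow> real"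
  assumes "0 < s" and "s \<le> 1"
    and "\<And>q. q \<ge> 1 \<Longrightarrow> \<psi> q \<ge> 0"
    and "summable (\<lambda>n. \<psi> (Suc n) powr s * real (Suc n) powr (2 - s))"
  shows "hausdorff_measure s (dual_approximable \<psi> \<inter> parabola) = 0"
proof -
  define e where "e n = \<psi> n powr s * real n powr (2 - s)" for n
  have sum_e: "summable e"
    using assms(4) unfolding e_def by (subst summable_Suc_iff[symmetric])
  define F where "F n = 976 * e n + 24 * ((real (card (double_root_triples n)))\<^sup>2 / (real n)\<^sup>2)" for n
  have sum_F: "summable F"
    unfolding F_def by (intro summable_add summable_mult sum_e summable_card_double_root_triples)
  \<comment> \<open>The terms tend to 0 while \<open>n powr (2 - s) \<ge> 1\<close>, so
    \<open>\<psi> n \<le> 1\<close> for large \<open>n\<close>, as the cover of one height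
    requires.\<close>
  have "eventually (\<lambda>n. e n < 1) sequentially"
    using summable_LIMSEQ_zero[OF sum_e] by (rule order_tendstoD) simp
  then obtain N0 where N0: "\<And>n. n \<ge> N0 \<Longrightarrow> e n < 1"
    by (auto simp: eventually_sequentially)
  define N where "N = max N0 1"
  have N: "n > 0" "0 \<le> \<psi> n" "\<psi> n \<le> 1" if "n \<ge> N" for n
  proof -
    show n: "n > 0" using that by (simp add: N_def)
    then show "0 \<le> \<psi> n" using assms(3) by simp
    show "\<psi> n \<le> 1"
    proof (rule ccontr)
      assume "\<not> ?thesis"
      then have "1 * 1 \<le> e n"
        unfolding e_def using assms(1,2) n by (intro mult_mono ge_one_powr_ge_zero) auto
      then show False using N0[of n] that by (simp add: N_def)
    qed
  qed
  define B where "B n = {x. \<exists>a b c. (a, b) \<in> pairs_of_height n \<and>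
      \<bar>of_int b * x\<^sup>2 + of_int a * x - of_int c\<bar> < \<psi> n}" for n
  define J where "J n = (pairs_of_height n \<times> {-int (3 * n)..int (3 * n)}) \<times> (UNIV :: bool set)" for n
  have "\<forall>n. \<exists>z r. n \<ge> N \<longrightarrow> (\<forall>j. 0 \<le> r j) \<and> B n \<inter> {0..1} \<subseteq> (\<Union>j\<in>J n. cball (z j) (r j)) \<and>
          (\<Sum>j\<in>J n. r j powr s) \<le> F n"
  proof
    fix n
    show "\<exists>z r. n \<ge> N \<longrightarrow> (\<forall>j. 0 \<le> r j) \<and> B n \<inter> {0..1} \<subseteq> (\<Union>j\<in>J n. cball (z j) (r j)) \<and>
          (\<Sum>j\<in>J n. r j powr s) \<le> F n"
    proof (cases "n \<ge> N")
      case True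
      show ?thesis
        using height_level_cover[OF N(1)[OF True] assms(1,2) N(2,3)[OF True]]
        unfolding B_def J_def F_def e_def by blast
    qed simp
  qed
  then obtain z r where zr: "\<And>n j. n \<ge> N \<Longrightarrow> 0 \<le> r n j"
      "\<And>n. n \<ge> N \<Longrightarrow> B n \<inter> {0..1} \<subseteq> (\<Union>j\<in>J n. cball (z n j) (r n j))"
      "\<And>n. n \<ge> N \<Longrightarrow> (\<Sum>j\<in>J n. r n j powr s) \<le> F n"
    unfolding choice_iff by blast
  have sub: "dual_approximable \<psi> \<inter> parabola \<subseteq>
          (\<lambda>x::real. vector [x, x\<^sup>2] :: real^2) ` {x\<in>{0..1}. infinite {n. x \<in> B n}}"
  proof
    fix u assume u: "u \<in> dual_approximable \<psi> \<inter> parabola"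
    then obtain x where x: "u = vector [x, x\<^sup>2]" "x \<in> {0..1}" by (auto simp: parabola_def)
    define Q where "Q = {q :: int ^ 2. q \<noteq> 0 \<and>
        dist_nearest_int ((\<chi> i. of_int (q $ i)) \<bullet> u) < \<psi> (max_norm q)}"
    have inf: "infinite Q" using u by (auto simp: dual_approximable_def Q_def)
    have "x \<in> B (max_norm q)" if "q \<in> Q" for q
    proof -
      have "(\<chi> i. real_of_int (q $ i)) \<bullet> u = of_int (q $ 2) * x\<^sup>2 + of_int (q $ 1) * x"
        by (simp add: inner_vec_def sum_2 x)
      moreover have "dist_nearest_int ((\<chi> i. of_int (q $ i)) \<bullet> u) < \<psi> (max_norm q)"
        using that by (simp add: Q_def)
      ultimately obtain c :: int where "\<bar>of_int (q $ 2) * x\<^sup>2 + of_int (q $ 1) * x - of_int c\<bar> < \<psi> (max_norm q)"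
        using dist_nearest_int_less_imp by metis
      moreover have "(q $ 1, q $ 2) \<in> pairs_of_height (max_norm q)"
        by (simp add: pairs_of_height_def max_norm_def)
      ultimately show ?thesis by (auto simp: B_def)
    qed
    \<comment> \<open>Each height is shared by finitely many \<open>q\<close>, so infinitely many
      \<open>q\<close> occupy infinitely many heights.\<close>
    then have "Q \<subseteq> (\<Union>n\<in>{n. x \<in> B n}. {q. max_norm q = n})" by auto
    then have "infinite {n. x \<in> B n}"
      using inf finite_subset finite_max_norm by (metis (no_types, lifting) finite_UN)
    then show "u \<in> (\<lambda>x::real. vector [x, x\<^sup>2] :: real^2) ` {x\<in>{0..1}. infinite {n. x \<in> B n}}"
      using x by auto
  qed
  show ?thesis
    by (rule hausdorff_measure_parabola_limsup_null[OF assms(1) sum_F _ zr(1) zr(2) zr(3) sub])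
       (auto simp: J_def)
qed

end
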